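(* Let $G$ be a finitely generated group. If $G$ contains an element of order at least $(5\operatorname{rank}(G))^{12}$ (infinite order being allowed), then $G$ has a locally finite directed Cayley graph whose only automorphisms are the left-multiplications by elements of $G$. If moreover $G$ is not a generalized dihedral group, then this digraph can be chosen without bigons.
   Context: A digraph is a pair $(V,E)$ with $E\subset V\times V$ disjoint from the diagonal; an automorphism is a permutation $\varphi$ of $V$ with $(x,y)\in E$ iff $(\varphi(x),\varphi(y))\in E$. A bigon is an arc $(x,y)$ such that $(y,x)$ is also an arc. For a generating set $S$ of $G$ with $1_G\notin S$, the directed Cayley graph of $(G,S)$ has vertex set $G$ and arc set $\{(g,gs)\mid g\in G,s\in S\}$; it is locally finite iff $S$ is finite. $\operatorname{rank}(G)$ is the smallest cardinality of a generating set of $G$. A generalized dihedral group is a semidirect product $A\rtimes \mathbf{Z}/2\mathbf{Z}$ with $A$ abelian and $\mathbf{Z}/2\mathbf{Z}$ acting on $A$ by inversion. *)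

theory Defs
  imports "HOL-Algebra.Algebra" "Graph_Theory.Pair_Digraph"
begin

section \<open>Groups\<close>

definition generating_set :: "('a, 'b) monoid_scheme \<Rightarrow> 'a set \<Rightarrow> bool" where
  "generating_set G S \<longleftrightarrow> S \<subseteq> carrier G \<and> generate G S = carrier G"

definition finitely_generated :: "('a, 'b) monoid_scheme \<Rightarrow> bool" where
  "finitely_generated G \<longleftrightarrow> (\<exists>S. finite S \<and> generating_set G S)"

text \<open>Only meaningful for finitely generated groups. Finiteness is required explicitly because
  \<^const>\<open>card\<close> is 0 on infinite sets.\<close>

definition group_rank :: "('a, 'b) monoid_scheme \<Rightarrow> nat" where
  "group_rank G = (LEAST n. \<exists>S. finite S \<and> generating_set G S \<and> card S = n)"

definition semidirect_product ::
  "('a, 'c) monoid_scheme \<Rightarrow> ('b, 'd) monoid_scheme \<Rightarrow> ('b \<Rightarrow> 'a \<Rightarrow> 'a) \<Rightarrow> ('a \<times> 'b) monoid" where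
  "semidirect_product N H \<phi> =
     \<lparr>carrier = carrier N \<times> carrier H,
      monoid.mult = (\<lambda>(a, h) (b, k). (a \<otimes>\<^bsub>N\<^esub> \<phi> h b, h \<otimes>\<^bsub>H\<^esub> k)),
      one = (\<one>\<^bsub>N\<^esub>, \<one>\<^bsub>H\<^esub>)\<rparr>"

definition dihedral_extension :: "('a, 'b) monoid_scheme \<Rightarrow> ('a \<times> int) monoid" where
  "dihedral_extension A =
     semidirect_product A (integer_mod_group 2) (\<lambda>e a. if e = 0 then a else inv\<^bsub>A\<^esub> a)"

text \<open>Taking \<open>A\<close> over the element type of \<open>G\<close> is no restriction: see
  \<open>generalized_dihedralI\<close> below.\<close>

definition generalized_dihedral :: "('a, 'b) monoid_scheme \<Rightarrow> bool" where
  "generalized_dihedral G \<longleftrightarrow> (\<exists>A :: 'a monoid. comm_group A \<and> G \<cong> dihedral_extension A)"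

lemma group_dihedral_extension:
  assumes "comm_group A"
  shows "group (dihedral_extension A)"
proof -
  interpret A: comm_group A by fact
  have Z2: "carrier (integer_mod_group 2) = {0, 1}"
    by (auto simp: carrier_integer_mod_group)
  note defs = dihedral_extension_def semidirect_product_def Z2
  show ?thesis
  proof (rule groupI)
    fix x y z
    assume "x \<in> carrier (dihedral_extension A)" "y \<in> carrier (dihedral_extension A)"
      "z \<in> carrier (dihedral_extension A)"
    then obtain a b c d e f where "x = (a, d)" "y = (b, e)" "z = (c, f)"
      "a \<in> carrier A" "b \<in> carrier A" "c \<in> carrier A" "d \<in> {0, 1}" "e \<in> {0, 1}" "f \<in> {0, 1}"
      by (auto simp: defs)
    then show "x \<otimes>\<^bsub>dihedral_extension A\<^esub> y \<otimes>\<^bsub>dihedral_extension A\<^esub> z =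
        x \<otimes>\<^bsub>dihedral_extension A\<^esub> (y \<otimes>\<^bsub>dihedral_extension A\<^esub> z)"
      by (elim insertE emptyE) (simp_all add: defs A.m_assoc A.inv_mult)
  next
    fix x assume "x \<in> carrier (dihedral_extension A)"
    then obtain a d where x: "x = (a, d)" "a \<in> carrier A" "d \<in> {0, 1}"
      by (auto simp: defs)
    let ?y = "(if d = 0 then inv\<^bsub>A\<^esub> a else a, d)"
    have "?y \<in> carrier (dihedral_extension A)"
      using x by (simp add: defs)
    moreover have "?y \<otimes>\<^bsub>dihedral_extension A\<^esub> x = \<one>\<^bsub>dihedral_extension A\<^esub>"
      using x by (elim insertE emptyE) (simp_all add: defs)
    ultimately show "\<exists>y \<in> carrier (dihedral_extension A).
        y \<otimes>\<^bsub>dihedral_extension A\<^esub> x = \<one>\<^bsub>dihedral_extension A\<^esub>" ..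
  qed (auto simp: defs)
qed

lemma generalized_dihedralI:
  fixes G :: "('a, 'b) monoid_scheme" and A :: "('c, 'd) monoid_scheme"
  assumes "group G" "comm_group A" "G \<cong> dihedral_extension A"
  shows "generalized_dihedral G"
proof -
  interpret A: comm_group A by fact
  interpret G: group G by fact
  have "dihedral_extension A \<cong> G"
    using assms(3) G.iso_sym by blast
  then obtain \<psi> where \<psi>: "\<psi> \<in> iso (dihedral_extension A) G"
    by (auto simp: is_iso_def)
  define f where "f a = \<psi> (a, 0)" for a
  have inj: "inj_on f (carrier A)"
  proof (rule inj_onI)
    fix a b assume "a \<in> carrier A" "b \<in> carrier A" "f a = f b"
    moreover from this have "(a, 0) \<in> carrier (dihedral_extension A)"
        "(b, 0) \<in> carrier (dihedral_extension A)"
      by (simp_all add: dihedral_extension_def semidirect_product_def carrier_integer_mod_group)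
    moreover have "inj_on \<psi> (carrier (dihedral_extension A))"
      using \<psi> by (simp add: iso_def bij_betw_def)
    ultimately show "a = b"
      by (auto simp: f_def dest: inj_onD)
  qed
  define g where "g = inv_into (carrier A) f"
  have gf: "g (f a) = a" if "a \<in> carrier A" for a
    using that inj by (simp add: g_def)
  define B :: "'a monoid" where
    "B = \<lparr>carrier = f ` carrier A, monoid.mult = \<lambda>x y. f (g x \<otimes>\<^bsub>A\<^esub> g y), one = f \<one>\<^bsub>A\<^esub>\<rparr>"
  have B: "comm_group B"
  proof (rule comm_groupI, goal_cases)
    case (6 x)
    then obtain a where "a \<in> carrier A" "x = f a" by (auto simp: B_def)
    then show ?case by (intro bexI[of _ "f (inv\<^bsub>A\<^esub> a)"]) (auto simp: B_def gf)
  qed (auto simp: B_def gf A.m_ac)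
  interpret B: comm_group B by fact
  have f_mult: "f (a \<otimes>\<^bsub>A\<^esub> b) = f a \<otimes>\<^bsub>B\<^esub> f b" if "a \<in> carrier A" "b \<in> carrier A" for a b
    using that by (simp add: B_def gf)
  have inv_f: "inv\<^bsub>B\<^esub> (f a) = f (inv\<^bsub>A\<^esub> a)" if "a \<in> carrier A" for a
    using that by (intro B.inv_equality) (auto simp: B_def gf)
  let ?h = "map_prod f (\<lambda>e :: int. e)"
  have "bij_betw ?h (carrier (dihedral_extension A)) (carrier (dihedral_extension B))"
    unfolding dihedral_extension_def semidirect_product_def
    using inj by (auto simp: bij_betw_def B_def intro!: map_prod_inj_on map_prod_surj_on)
  moreover have "?h \<in> hom (dihedral_extension A) (dihedral_extension B)"
  proof (rule homI)
    fix x assume "x \<in> carrier (dihedral_extension A)"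
    then show "?h x \<in> carrier (dihedral_extension B)"
      by (auto simp: dihedral_extension_def semidirect_product_def B_def)
  next
    fix x y assume "x \<in> carrier (dihedral_extension A)" "y \<in> carrier (dihedral_extension A)"
    then obtain a d b e where "x = (a, d)" "y = (b, e)" "a \<in> carrier A" "b \<in> carrier A"
      by (auto simp: dihedral_extension_def semidirect_product_def)
    then show "?h (x \<otimes>\<^bsub>dihedral_extension A\<^esub> y) = ?h x \<otimes>\<^bsub>dihedral_extension B\<^esub> ?h y"
      using inv_f f_mult by (simp add: dihedral_extension_def semidirect_product_def)
  qed
  ultimately have "?h \<in> iso (dihedral_extension A) (dihedral_extension B)"
    by (simp add: iso_def)
  then have "dihedral_extension A \<cong> dihedral_extension B"
    by (auto simp: is_iso_def)
  then have "G \<cong> dihedral_extension B"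
    using assms(3) iso_trans by blast
  with B show ?thesis
    by (auto simp: generalized_dihedral_def)
qed


section \<open>Digraphs\<close>

text \<open>A permutation of the vertex set is represented by an extensional function, as in
  \<^const>\<open>Bij\<close>, so that distinct functions are distinct permutations.\<close>

definition digraph_automorphisms :: "'a pair_pre_digraph \<Rightarrow> ('a \<Rightarrow> 'a) set" where
  "digraph_automorphisms D =
     {\<phi> \<in> Bij (pverts D). \<forall>x \<in> pverts D. \<forall>y \<in> pverts D. (x, y) \<in> parcs D \<longleftrightarrow> (\<phi> x, \<phi> y) \<in> parcs D}"

definition bigon :: "'a pair_pre_digraph \<Rightarrow> 'a \<times> 'a \<Rightarrow> bool" where
  "bigon D e \<longleftrightarrow> e \<in> parcs D \<and> (snd e, fst e) \<in> parcs D"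

definition locally_finite :: "'a pair_pre_digraph \<Rightarrow> bool" where
  "locally_finite D \<longleftrightarrow> (\<forall>v \<in> pverts D. finite (out_arcs D v) \<and> finite (in_arcs D v))"

definition cayley_digraph :: "('a, 'b) monoid_scheme \<Rightarrow> 'a set \<Rightarrow> 'a pair_pre_digraph" where
  "cayley_digraph G S =
     \<lparr>pverts = carrier G, parcs = {(g, g \<otimes>\<^bsub>G\<^esub> s) | g s. g \<in> carrier G \<and> s \<in> S}\<rparr>"

definition is_cayley_digraph :: "('a, 'b) monoid_scheme \<Rightarrow> 'a pair_pre_digraph \<Rightarrow> bool" where
  "is_cayley_digraph G D \<longleftrightarrow>
     (\<exists>S. generating_set G S \<and> \<one>\<^bsub>G\<^esub> \<notin> S \<and> D = cayley_digraph G S)"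

definition left_multiplications :: "('a, 'b) monoid_scheme \<Rightarrow> ('a \<Rightarrow> 'a) set" where
  "left_multiplications G = (\<lambda>g. \<lambda>x \<in> carrier G. g \<otimes>\<^bsub>G\<^esub> x) ` carrier G"

lemma pair_loopfree_digraph_cayley:
  assumes "group G" "is_cayley_digraph G D"
  shows "pair_loopfree_digraph D"
proof -
  interpret group G by fact
  from assms(2) obtain S where S: "S \<subseteq> carrier G" "\<one>\<^bsub>G\<^esub> \<notin> S" "D = cayley_digraph G S"
    by (auto simp: is_cayley_digraph_def generating_set_def)
  have "g \<otimes>\<^bsub>G\<^esub> s \<in> carrier G \<and> g \<noteq> g \<otimes>\<^bsub>G\<^esub> s" if "g \<in> carrier G" "s \<in> S" for g s
  proof -
    have "s \<in> carrier G" "s \<noteq> \<one>\<^bsub>G\<^esub>"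
      using that S by auto
    then show ?thesis
      using that l_cancel_one'[of g s] by simp
  qed
  moreover have "\<exists>g s. e = (g, g \<otimes>\<^bsub>G\<^esub> s) \<and> g \<in> carrier G \<and> s \<in> S" if "e \<in> parcs D" for e
    using that S(3) by (simp add: cayley_digraph_def)
  ultimately show ?thesis
    using S(3) by unfold_locales (fastforce simp: cayley_digraph_def)+
qed

lemma locally_finite_cayley_iff:
  assumes "group G" "S \<subseteq> carrier G"
  shows "locally_finite (cayley_digraph G S) \<longleftrightarrow> finite S"
proof -
  interpret group G by fact
  let ?D = "cayley_digraph G S"
  have o: "out_arcs ?D v = (\<lambda>s. (v, v \<otimes>\<^bsub>G\<^esub> s)) ` S" if "v \<in> carrier G" for v
    using that by (auto simp: out_arcs_def cayley_digraph_def)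
  have i: "in_arcs ?D v \<subseteq> (\<lambda>s. (v \<otimes>\<^bsub>G\<^esub> inv\<^bsub>G\<^esub> s, v)) ` S" if "v \<in> carrier G" for v
  proof
    fix e assume "e \<in> in_arcs ?D v"
    then obtain g s where gs: "e = (g, v)" "v = g \<otimes>\<^bsub>G\<^esub> s" "g \<in> carrier G" "s \<in> S"
      by (auto simp: in_arcs_def cayley_digraph_def)
    then have "g = v \<otimes>\<^bsub>G\<^esub> inv\<^bsub>G\<^esub> s"
      using assms(2) by (simp add: m_assoc subset_eq)
    with gs show "e \<in> (\<lambda>s. (v \<otimes>\<^bsub>G\<^esub> inv\<^bsub>G\<^esub> s, v)) ` S"
      by blast
  qed
  have "inj_on (\<lambda>s. (\<one>\<^bsub>G\<^esub>, \<one>\<^bsub>G\<^esub> \<otimes>\<^bsub>G\<^esub> s)) S"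
    using assms(2) by (auto simp: inj_on_def subset_eq)
  then have "finite S" if "finite (out_arcs ?D \<one>\<^bsub>G\<^esub>)"
    using that o[of "\<one>\<^bsub>G\<^esub>"] by (auto dest: finite_imageD)
  moreover have "finite (in_arcs ?D v)" "finite (out_arcs ?D v)" if "finite S" "v \<in> carrier G" for v
    using that finite_subset[OF i] by (auto simp: o)
  ultimately show ?thesis
    by (auto simp: locally_finite_def cayley_digraph_def)
qed

lemma left_multiplications_subset_automorphisms:
  assumes "group G" "is_cayley_digraph G D"
  shows "left_multiplications G \<subseteq> digraph_automorphisms D"
proof -
  interpret group G by fact
  from assms(2) obtain S where S: "S \<subseteq> carrier G" "D = cayley_digraph G S"
    by (auto simp: is_cayley_digraph_def generating_set_def)
  show ?thesis
  proof
    fix \<phi> assume "\<phi> \<in> left_multiplications G"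
    then obtain g where g: "g \<in> carrier G" "\<phi> = (\<lambda>x \<in> carrier G. g \<otimes>\<^bsub>G\<^esub> x)"
      by (auto simp: left_multiplications_def)
    have "bij_betw \<phi> (carrier G) (carrier G)"
      using g by (intro bij_betwI[of _ _ _ "\<lambda>x. inv\<^bsub>G\<^esub> g \<otimes>\<^bsub>G\<^esub> x"])
        (auto simp: m_assoc[symmetric])
    then have "\<phi> \<in> Bij (carrier G)"
      using g by (auto simp: Bij_def)
    moreover have "(x, y) \<in> parcs D \<longleftrightarrow> (\<phi> x, \<phi> y) \<in> parcs D"
      if "x \<in> carrier G" "y \<in> carrier G" for x y
    proof -
      have "y = x \<otimes>\<^bsub>G\<^esub> s \<longleftrightarrow> g \<otimes>\<^bsub>G\<^esub> y = (g \<otimes>\<^bsub>G\<^esub> x) \<otimes>\<^bsub>G\<^esub> s" if "s \<in> S" for s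
        using that g S \<open>x \<in> carrier G\<close> \<open>y \<in> carrier G\<close> by (simp add: m_assoc subset_eq)
      then show ?thesis
        using that g S by (auto simp: cayley_digraph_def)
    qed
    ultimately show "\<phi> \<in> digraph_automorphisms D"
      using S by (auto simp: digraph_automorphisms_def cayley_digraph_def)
  qed
qed

end

theory Submission
  imports Defs
begin

text \<open>Let \<open>x\<close> be an element of large order, \<open>H\<close> the cyclic subgroup it generates, and
  take \<open>S = {x, x\<^sup>2, \<dots>, x\<^sup>M} \<union> Y\<close> with \<open>Y\<close> finite and disjoint from \<open>H\<close>. An arc with
  label in \<open>Y\<close> lies in at most \<open>4|Y|\<close> triangles of two given orientations, an arc with label
  \<open>x\<^sup>k\<close> in at least \<open>M - 1\<close>. So for \<open>M\<close> large every automorphism \<open>\<phi>\<close> preserves the set of arcs of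
  the second kind, and since \<open>x\<close> is the only label among them that is not a product of two others,
  \<open>\<phi> (g x) = \<phi> g x\<close>. Hence if \<open>\<phi> (g y) = \<phi> g y'\<close> with \<open>y, y' \<in> Y\<close>, then
  \<open>{h \<in> H. y h \<in> Y} = {h \<in> H. y' h \<in> Y}\<close>. Choosing \<open>Y\<close> to meet distinct cosets \<open>y H\<close> in asymmetric
  blocks of distinct sizes, one such block per generator, makes this pattern determine \<open>y\<close>, so \<open>\<phi>\<close>
  preserves all labels.

  Bigons can be avoided by a greedy choice inside each coset \<open>t H\<close>, unless all its elements
  are involutions. If such cosets cannot be dispensed with, i.e. if some such \<open>t\<close> has the property
  that \<open>t g H\<close> is of this kind whenever \<open>g H\<close> is not, then \<open>t\<close> inverts the centralizer of \<open>x\<close>, which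
  has index 2, and \<open>G\<close> is generalized dihedral.\<close>

section \<open>Cosets of involutions\<close>

context group
begin

text \<open>The two equations force \<open>u x\<^sup>j\<close> to have square 1 for every \<open>j\<close>.\<close>

definition coinvolution :: "'a \<Rightarrow> 'a \<Rightarrow> bool" where
  "coinvolution x u \<longleftrightarrow> u \<otimes> u = \<one> \<and> (u \<otimes> x) \<otimes> (u \<otimes> x) = \<one>"

text \<open>With \<open>v = u \<otimes> x\<close>, the hypothesis says that \<open>v\<close> and
  \<open>v \<otimes> x\<close> square to 1. So \<open>v\<close> conjugates \<open>x\<close> to its
  inverse, and \<open>v \<otimes> inv x\<close> squares to 1 too.\<close>

lemma coinvolution_cancel:
  assumes x: "x \<in> carrier G" and u: "u \<in> carrier G" and "coinvolution x (u \<otimes> x)"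
  shows "coinvolution x u"
proof -
  define v where "v = u \<otimes> x"
  have v: "v \<in> carrier G" "u = v \<otimes> inv x"
    using x u by (simp_all add: v_def m_assoc)
  have 1: "v \<otimes> v = \<one>" and 2: "v \<otimes> x \<otimes> (v \<otimes> x) = \<one>"
    using assms(3) by (auto simp: coinvolution_def v_def)
  have iv: "inv v = v" using 1 v by (simp add: inv_equality)
  have "x \<otimes> (v \<otimes> x) = v"
    using 2 1 v x by (metis inv_equality iv inv_inv m_assoc m_closed)
  then have "x \<otimes> v \<otimes> (x \<otimes> v) = \<one>"
    using 1 v x by (metis m_assoc m_closed)
  then have "inv (x \<otimes> v \<otimes> (x \<otimes> v)) = \<one>" by simp
  then have "u \<otimes> u = \<one>"
    using v x iv by (simp add: inv_mult_group)
  then show ?thesis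
    using 1 by (simp add: coinvolution_def v_def)
qed

text \<open>Used in contrapositive form: if \<open>u\<close> is not a coinvolution, then of two
  consecutive elements \<open>u x^j\<close>, \<open>u x^(j+1)\<close> at least one has square
  different from 1.\<close>

lemma coinvolution_of_pow:
  assumes x: "x \<in> carrier G" and u: "u \<in> carrier G"
    and "coinvolution x (u \<otimes> x [^] (j::nat))"
  shows "coinvolution x u"
  using assms(3)
proof (induction j)
  case (Suc j)
  then show ?case
    using coinvolution_cancel[OF x, of "u \<otimes> x [^] j"] x u by (simp add: m_assoc)
qed (use u in simp)

lemma coinvolution_conj:
  assumes x: "x \<in> carrier G" and u: "u \<in> carrier G" and "coinvolution x u"
  shows "inv u = u" "u \<otimes> x = inv x \<otimes> u"
proof -
  show *: "inv u = u"
    using assms by (simp add: coinvolution_def inv_equality)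
  have "inv (u \<otimes> x) = u \<otimes> x"
    using assms by (simp add: coinvolution_def inv_equality)
  then show "u \<otimes> x = inv x \<otimes> u"
    using x u * by (simp add: inv_mult_group)
qed

text \<open>Coinvolutions conjugate \<open>x\<close> to its inverse, so none lies in the centralizer
  \<open>C\<close> of \<open>x\<close>. Hence \<open>s \<otimes> g\<close> is a coinvolution for
  every \<open>g\<close> in \<open>C\<close>, which says that \<open>s\<close> inverts
  \<open>C\<close>; therefore \<open>C\<close> is abelian. For every \<open>g\<close>, one of
  \<open>g\<close> and \<open>s \<otimes> g\<close> centralizes \<open>x\<close>, so
  \<open>C\<close> has index 2.\<close>

lemma generalized_dihedral_if_coinvolution:
  assumes x: "x \<in> carrier G" "x \<otimes> x \<noteq> \<one>"
    and s: "s \<in> carrier G" "coinvolution x s"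
    and all: "\<And>g. g \<in> carrier G \<Longrightarrow> \<not> coinvolution x g \<Longrightarrow> coinvolution x (s \<otimes> g)"
  shows "generalized_dihedral G"
proof -
  define C where "C = {g \<in> carrier G. g \<otimes> x = x \<otimes> g}"
  note conj = coinvolution_conj[OF x(1)]
  have s': "inv s = s" "s \<otimes> s = \<one>" "s \<otimes> x = inv x \<otimes> s"
    using conj[OF s] s by (auto simp: coinvolution_def)
  have s2: "s \<otimes> inv x = x \<otimes> s"
  proof -
    have "x \<otimes> s = x \<otimes> (s \<otimes> x) \<otimes> inv x" using s x by (simp add: m_assoc)
    also have "\<dots> = s \<otimes> inv x" using s x by (simp add: s'(3) flip: m_assoc)
    finally show ?thesis by simp
  qed
  have sC: "s \<otimes> g \<in> C" if "g \<in> carrier G" "g \<otimes> x = inv x \<otimes> g" for g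
  proof -
    have "s \<otimes> g \<otimes> x = s \<otimes> (inv x \<otimes> g)" using that s x by (simp add: m_assoc)
    also have "\<dots> = x \<otimes> (s \<otimes> g)" using that s x s2 by (metis inv_closed m_assoc)
    finally show ?thesis using that s by (simp add: C_def)
  qed
  have good: "\<not> coinvolution x g" if "g \<in> C" for g
  proof
    assume *: "coinvolution x g"
    have g: "g \<in> carrier G" "g \<otimes> x = x \<otimes> g" using that by (auto simp: C_def)
    then have "x = inv x" using conj(2)[OF g(1) *] x by (simp add: right_cancel)
    then show False using x by (metis r_inv)
  qed
  \<comment> \<open>Two elements that conjugate \<open>x\<close> to its inverse have their product
    in \<open>C\<close>. This applies to \<open>s\<close> and \<open>g\<close> if \<open>g\<close>
    is a coinvolution, and otherwise to \<open>s\<close> and \<open>s \<otimes> g\<close>, whose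
    product is \<open>g\<close>.\<close>
  have C: "g \<in> C \<or> s \<otimes> g \<in> C" if "g \<in> carrier G" for g
  proof (cases "coinvolution x g")
    case True
    then show ?thesis using sC conj(2) that by blast
  next
    case False
    then have "s \<otimes> g \<otimes> x = inv x \<otimes> (s \<otimes> g)" using all that s conj(2) by blast
    then have "s \<otimes> (s \<otimes> g) \<in> C" using sC[of "s \<otimes> g"] that s by simp
    then show ?thesis using that s s' by (simp flip: m_assoc)
  qed
  have sub: "subgroup C G"
  proof (rule subgroupI)
    show "C \<subseteq> carrier G" "C \<noteq> {}" using x by (auto simp: C_def)
    show "inv a \<in> C" if "a \<in> C" for a
    proof -
      have a: "a \<in> carrier G" "a \<otimes> x = x \<otimes> a" using that by (auto simp: C_def)
      have "inv a \<otimes> x = inv a \<otimes> (x \<otimes> a) \<otimes> inv a" using a(1) x by (simp add: m_assoc)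
      also have "\<dots> = x \<otimes> inv a" using a(1) x by (simp flip: a(2) m_assoc)
      finally show ?thesis using a by (simp add: C_def)
    qed
    show "a \<otimes> b \<in> C" if "a \<in> C" "b \<in> C" for a b
    proof -
      have ab: "a \<in> carrier G" "a \<otimes> x = x \<otimes> a" "b \<in> carrier G" "b \<otimes> x = x \<otimes> b"
        using that by (auto simp: C_def)
      have "a \<otimes> b \<otimes> x = a \<otimes> (b \<otimes> x)" using ab x by (simp add: m_assoc)
      also have "\<dots> = a \<otimes> x \<otimes> b" unfolding ab(4) using ab(1,3) x by (simp add: m_assoc)
      also have "\<dots> = x \<otimes> (a \<otimes> b)" using ab(1,3) x by (simp add: ab(2) m_assoc)
      finally show ?thesis using ab by (simp add: C_def)
    qed
  qed
  interpret C: group "G\<lparr>carrier := C\<rparr>"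
    using sub by (rule subgroup_imp_group)
  have Csub: "a \<in> carrier G" if "a \<in> C" for a using that by (simp add: C_def)
  have sg: "s \<otimes> g = inv g \<otimes> s" if "g \<in> C" for g
  proof -
    have "coinvolution x (s \<otimes> g)" using all good that Csub by blast
    then have "inv (s \<otimes> g) = s \<otimes> g" using conj(1)[of "s \<otimes> g"] Csub[OF that] s by simp
    then show ?thesis using s s' that Csub by (simp add: inv_mult_group)
  qed
  \<comment> \<open>Conjugation by \<open>s\<close> is a homomorphism and acts on \<open>C\<close>
    as inversion; a group in which inversion is a homomorphism is abelian.\<close>
  have comm: "g \<otimes> h = h \<otimes> g" if "g \<in> C" "h \<in> C" for g h
  proof -
    have gh: "g \<in> carrier G" "h \<in> carrier G" "g \<otimes> h \<in> C"
      using that sub Csub by (auto intro: subgroup.m_closed)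
    have "inv (g \<otimes> h) \<otimes> s = s \<otimes> (g \<otimes> h)" using sg gh by simp
    also have "\<dots> = inv g \<otimes> (s \<otimes> h)" using sg[OF that(1)] gh s by (metis inv_closed m_assoc)
    also have "\<dots> = inv g \<otimes> inv h \<otimes> s" using sg[OF that(2)] gh s by (simp add: m_assoc)
    finally have "inv (g \<otimes> h) = inv g \<otimes> inv h" using gh s by (simp add: right_cancel)
    then show ?thesis using gh by (metis inv_inv inv_mult_group m_closed)
  qed
  have commC: "comm_group (G\<lparr>carrier := C\<rparr>)"
    using comm by (intro C.group_comm_groupI) auto
  let ?A = "G\<lparr>carrier := C\<rparr>"
  let ?D = "dihedral_extension ?A"
  have invA: "inv\<^bsub>?A\<^esub> a = inv a" if "a \<in> C" for a
    using that sub by (simp add: m_inv_consistent)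
  have Z2: "carrier (integer_mod_group 2) = {0, 1}"
    by (auto simp: carrier_integer_mod_group)
  note defs = dihedral_extension_def semidirect_product_def Z2
  let ?f = "\<lambda>(a, e::int). if e = 0 then a else a \<otimes> s"
  have sC': "s \<notin> C" using good s by blast
  have "?f \<in> iso ?D G"
  proof (rule isoI)
    show "?f \<in> hom ?D G"
    proof (rule homI)
      fix p q assume "p \<in> carrier ?D" "q \<in> carrier ?D"
      then obtain a b d e where pq: "p = (a, d)" "q = (b, e)" "a \<in> C" "b \<in> C"
        "d \<in> {0, 1}" "e \<in> {0, 1}" by (auto simp: defs)
      have ab: "a \<in> carrier G" "b \<in> carrier G" using pq Csub by auto
      have 1: "a \<otimes> s \<otimes> b = a \<otimes> inv b \<otimes> s"
        using ab s sg[OF pq(4)] by (simp add: m_assoc)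
      then have 2: "a \<otimes> s \<otimes> (b \<otimes> s) = a \<otimes> inv b"
        using ab s s' by (metis inv_closed m_assoc m_closed r_one)
      show "?f (p \<otimes>\<^bsub>?D\<^esub> q) = ?f p \<otimes> ?f q"
        using pq ab s 1 2 by (elim insertE emptyE) (simp_all add: defs invA m_assoc)
    qed (use s Csub in \<open>auto simp: defs\<close>)
    show "bij_betw ?f (carrier ?D) (carrier G)"
    proof (rule bij_betw_imageI)
      have "a \<otimes> s \<notin> C" if "a \<in> C" for a
      proof
        assume "a \<otimes> s \<in> C"
        then have "inv a \<otimes> (a \<otimes> s) \<in> C" using that sub by (meson subgroup_def)
        then show False using that s sC' Csub by (simp flip: m_assoc)
      qed
      then show "inj_on ?f (carrier ?D)"
        using s Csub by (fastforce simp: inj_on_def defs)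
      show "?f ` carrier ?D = carrier G"
      proof
        show "?f ` carrier ?D \<subseteq> carrier G" using s Csub by (auto simp: defs)
        show "carrier G \<subseteq> ?f ` carrier ?D"
        proof
          fix g assume g: "g \<in> carrier G"
          show "g \<in> ?f ` carrier ?D"
          proof (cases "g \<in> C")
            case True
            then have "(g, 0) \<in> carrier ?D" "?f (g, 0) = g" by (auto simp: defs)
            then show ?thesis by force
          next
            case False
            then have *: "s \<otimes> g \<in> C" using C g by blast
            then have "inv (s \<otimes> g) \<in> C" using sub by (simp add: subgroup.m_inv_closed)
            moreover have "inv (s \<otimes> g) \<otimes> s = g"
              using sg[OF *] s s' g by (metis m_assoc l_one)
            ultimately have "(inv (s \<otimes> g), 1) \<in> carrier ?D" "?f (inv (s \<otimes> g), 1) = g"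
              by (auto simp: defs)
            then show ?thesis by force
          qed
        qed
      qed
    qed
  qed
  then have "?D \<cong> G" by (auto simp: is_iso_def)
  then have "G \<cong> ?D"
    using group.iso_sym[OF group_dihedral_extension[OF commC]] by blast
  then show ?thesis using generalized_dihedralI is_group commC by blast
qed


section \<open>Asymmetric sets of labels\<close>

lemma pow_minus_eq_one:
  assumes "x \<in> carrier G" "x [^] (a::nat) = x [^] b" "a \<le> b"
  shows "x [^] (b - a) = \<one>"
proof -
  have "x [^] a \<otimes> x [^] (b - a) = x [^] b"
    using assms(1,3) by (simp add: nat_pow_mult)
  then show ?thesis using assms(1,2) by (metis l_cancel_one nat_pow_closed)
qed

text \<open>Assuming nontrivial powers only up to a bound treats infinite order and large finite
  order at once.\<close>

lemma inj_on_pow: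
  assumes "x \<in> carrier G" "\<And>k. 0 < k \<Longrightarrow> k \<le> K \<Longrightarrow> x [^] k \<noteq> \<one>"
  shows "inj_on (\<lambda>j::nat. x [^] j) {..K}"
proof (rule linorder_inj_onI)
  fix a b assume "a < b" "a \<in> {..K}" "b \<in> {..K}"
  then show "x [^] a \<noteq> x [^] b"
    using pow_minus_eq_one[OF assms(1), of a b] assms(2)[of "b - a"] by auto
qed auto

text \<open>Pigeonhole: \<open>card F + 1\<close> distinct elements of the coset cannot all lie in
  \<open>F\<close>. The factor 2 in the bound leaves room for passing over elements with square
  1.\<close>

lemma ex_pow_outside:
  assumes x: "x \<in> carrier G" and ord: "\<And>k. 0 < k \<Longrightarrow> k \<le> L \<Longrightarrow> x [^] k \<noteq> \<one>"
    and y: "y \<in> carrier G" and F: "finite F" "2 * card F + 1 \<le> L"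
  shows "\<exists>j\<le>L. y \<otimes> x [^] (j::nat) \<notin> F \<and>
    (\<not> coinvolution x y \<longrightarrow> (y \<otimes> x [^] j) \<otimes> (y \<otimes> x [^] j) \<noteq> \<one>)"
proof (rule ccontr)
  assume *: "\<not> ?thesis"
  let ?sq = "\<lambda>j::nat. (y \<otimes> x [^] j) \<otimes> (y \<otimes> x [^] j)"
  \<comment> \<open>Two consecutive \<open>y x\<^sup>j\<close> with square 1 force \<open>coinvolution x y\<close>, so each pair \<open>2i, 2i + 1\<close> has a usable member.\<close>
  define d where "d i = (if ?sq (2 * i) = \<one> then 2 * i + 1 else 2 * i)" for i
  have sq: "?sq (d i) \<noteq> \<one>" if "\<not> coinvolution x y" for i
  proof
    assume "?sq (d i) = \<one>"
    then have "coinvolution x (y \<otimes> x [^] (2 * i))"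
      using x y by (auto simp: coinvolution_def d_def m_assoc split: if_splits)
    then show False using that coinvolution_of_pow x y by blast
  qed
  have dL: "d i \<le> L" if "i \<le> card F" for i using that F by (auto simp: d_def)
  have "inj_on (\<lambda>j::nat. x [^] j) (d ` {..card F})"
    using dL by (intro inj_on_subset[OF inj_on_pow[OF x ord]]) auto
  then have "inj_on (\<lambda>j. y \<otimes> x [^] j) (d ` {..card F})"
    using x y by (simp add: inj_on_def)
  moreover have "inj_on d {..card F}"
    by (rule inj_on_inverseI[where g = "\<lambda>i. i div 2"]) (simp add: d_def)
  ultimately have "card ((\<lambda>j. y \<otimes> x [^] j) ` d ` {..card F}) = card F + 1"
    by (simp add: card_image)
  moreover have "(\<lambda>j. y \<otimes> x [^] j) ` d ` {..card F} \<subseteq> F" using * sq dL by blast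
  ultimately show False using card_mono[OF F(1)] by (metis Suc_eq_plus1 not_less_eq_eq order_refl)
qed

text \<open>The arc \<open>(g, g s)\<close> is a bigon exactly when \<open>inv s\<close> is a label
  too. The case \<open>u = v\<close> excludes involutions.\<close>

definition bigon_free :: "'a set \<Rightarrow> bool" where
  "bigon_free Y \<longleftrightarrow> (\<forall>u\<in>Y. \<forall>v\<in>Y. u \<otimes> v \<noteq> \<one>)"

text \<open>Greedy choice. The last of \<open>n\<close> picks has to avoid the \<open>n - 1\<close>
  elements chosen before and the inverses of these and of \<open>Y\<close>, at most
  \<open>card Y + 2 * (n - 1)\<close> elements in all. The disjunct \<open>n = 0\<close> deals with
  the truncated subtraction.\<close>

lemma ex_block:
  assumes x: "x \<in> carrier G" and ord: "\<And>k. 0 < k \<Longrightarrow> k \<le> L \<Longrightarrow> x [^] k \<noteq> \<one>"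
    and y: "y \<in> carrier G" and Y: "finite Y" "Y \<subseteq> carrier G"
    and "n = 0 \<or> 2 * (card Y + 2 * (n - 1)) + 1 \<le> L"
  shows "\<exists>B. B \<subseteq> (\<lambda>j::nat. y \<otimes> x [^] j) ` {..L} \<and> card B = n \<and>
    (bigon_free Y \<and> \<not> coinvolution x y \<longrightarrow> bigon_free (Y \<union> B))"
  using assms(6)
proof (induction n)
  case 0
  then show ?case by (intro exI[of _ "{}"]) auto
next
  case (Suc n)
  have "n = 0 \<or> 2 * (card Y + 2 * (n - 1)) + 1 \<le> L" using Suc.prems by auto
  from Suc.IH[OF this] obtain B where B: "B \<subseteq> (\<lambda>j::nat. y \<otimes> x [^] j) ` {..L}" "card B = n"
    "bigon_free Y \<Longrightarrow> \<not> coinvolution x y \<Longrightarrow> bigon_free (Y \<union> B)" by blast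
  have fB: "finite B" using B(1) by (rule finite_subset) auto
  have cB: "B \<subseteq> carrier G" using B(1) x y by auto
  let ?F = "B \<union> m_inv G ` (Y \<union> B)"
  have "card ?F \<le> card B + card (m_inv G ` (Y \<union> B))" by (rule card_Un_le)
  also have "card (m_inv G ` (Y \<union> B)) \<le> card (Y \<union> B)" using fB Y by (intro card_image_le) auto
  also have "\<dots> \<le> card Y + card B" by (rule card_Un_le)
  finally have "2 * card ?F + 1 \<le> L" using Suc.prems B(2) by auto
  then obtain j where j: "j \<le> L" "y \<otimes> x [^] j \<notin> ?F"
    "\<not> coinvolution x y \<Longrightarrow> (y \<otimes> x [^] j) \<otimes> (y \<otimes> x [^] j) \<noteq> \<one>"
    using ex_pow_outside[OF x ord y, of L ?F] fB Y by auto
  define z where "z = y \<otimes> x [^] j"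
  have z: "z \<in> carrier G" using x y by (simp add: z_def)
  have free: "z \<otimes> v \<noteq> \<one>" "v \<otimes> z \<noteq> \<one>" if "v \<in> Y \<union> B" for v
  proof -
    have "v \<in> carrier G" "z \<noteq> inv v" using that cB Y j by (auto simp: z_def)
    then show "z \<otimes> v \<noteq> \<one>" "v \<otimes> z \<noteq> \<one>" using z by (metis inv_equality inv_inv)+
  qed
  have "bigon_free (Y \<union> insert z B)" if "bigon_free Y" "\<not> coinvolution x y"
    using B(3)[OF that] j(3)[OF that(2)] free by (auto simp: bigon_free_def z_def)
  then show ?case
    using B j fB by (intro exI[of _ "insert z B"]) (auto simp: z_def)
qed

text \<open>This is \<open>H\<close> intersected with the left translate of \<open>Y\<close> by
  \<open>inv y\<close>. It is an invariant of the label: an automorphism that commutes with right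
  multiplication by \<open>H\<close> can only replace \<open>y\<close> by a label in
  \<open>Y\<close> with the same pattern.\<close>

definition right_pattern :: "'a set \<Rightarrow> 'a set \<Rightarrow> 'a \<Rightarrow> 'a set" where
  "right_pattern H Y y = {h \<in> H. y \<otimes> h \<in> Y}"

text \<open>Let \<open>m\<close> be the largest exponent in \<open>J\<close>, and
  \<open>a < b\<close>. Then \<open>x^(m - a)\<close> is in the pattern at exponent
  \<open>a\<close>, but from exponent \<open>b\<close> it leads past \<open>m\<close>. To land in
  the block again would require \<open>x^k = 1\<close> for some
  \<open>0 < k \<le> 2 * L\<close>.\<close>

lemma inj_on_right_pattern_block:
  assumes x: "x \<in> carrier G" and ord: "\<And>k. 0 < k \<Longrightarrow> k \<le> 2 * L \<Longrightarrow> x [^] k \<noteq> \<one>"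
    and y: "y \<in> carrier G" and B: "B \<subseteq> (\<lambda>j::nat. y \<otimes> x [^] j) ` {..L}"
    and H: "\<And>k::nat. x [^] k \<in> H"
  shows "inj_on (right_pattern H B) B"
proof -
  let ?p = "\<lambda>j::nat. y \<otimes> x [^] j"
  define J where "J = {j. j \<le> L \<and> ?p j \<in> B}"
  have J: "finite J" by (auto simp: J_def)
  have "right_pattern H B (?p a) \<noteq> right_pattern H B (?p b)" if "a \<in> J" "b \<in> J" "a < b" for a b
  proof
    assume eq: "right_pattern H B (?p a) = right_pattern H B (?p b)"
    define m where "m = Max J"
    have "m \<in> J" unfolding m_def using that J by (intro Max_in) auto
    then have m: "m \<in> J" "a \<le> m" "\<And>c. c \<in> J \<Longrightarrow> c \<le> m"
      using that J by (auto simp: m_def)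
    have sh: "?p c \<otimes> x [^] (m - a) = ?p (c + (m - a))" for c
      using x y by (simp add: m_assoc nat_pow_mult)
    have "x [^] (m - a) \<in> right_pattern H B (?p a)"
      using m sh[of a] H by (simp add: right_pattern_def J_def)
    then have "x [^] (m - a) \<in> right_pattern H B (?p b)" by (simp only: eq)
    then have "?p (b + (m - a)) \<in> B" using sh[of b] by (simp add: right_pattern_def)
    then obtain c where c: "c \<le> L" "?p (b + (m - a)) = ?p c" using B by auto
    then have "?p c \<in> B" using \<open>?p (b + (m - a)) \<in> B\<close> by simp
    then have "c \<le> m" using m c by (auto simp: J_def)
    have "x [^] c = x [^] (b + (m - a))" using c x y by (metis l_cancel nat_pow_closed)
    then have "x [^] (b + (m - a) - c) = \<one>" using x that \<open>c \<le> m\<close> m by (intro pow_minus_eq_one) auto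
    moreover have "0 < b + (m - a) - c" "b + (m - a) - c \<le> 2 * L"
      using that \<open>c \<le> m\<close> m by (auto simp: J_def)
    ultimately show False using ord by blast
  qed
  then have "inj_on (\<lambda>j. right_pattern H B (?p j)) J"
    by (intro linorder_inj_onI) auto
  moreover have "B = ?p ` J" using B by (auto simp: J_def)
  ultimately show ?thesis by (auto simp: inj_on_def)
qed

text \<open>Induction on the generators. One that already lies in the subgroup generated by
  \<open>Y \<union> H\<close> is skipped; any other adds a block in its coset \<open>t H\<close>,
  larger than all earlier blocks. Patterns from different blocks then differ in size, those within a
  block by \<open>inj_on_right_pattern_block\<close>. The square bounds the sum of block sizes at
  most 1, 2, 3 and so on.\<close>

lemma ex_rigid_set:
  assumes x: "x \<in> carrier G" and ord: "\<And>k. 0 < k \<Longrightarrow> k \<le> 4 * m\<^sup>2 + 2 \<Longrightarrow> x [^] k \<noteq> \<one>"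
    and H: "subgroup H G" "x \<in> H"
    and T: "finite T" "T \<subseteq> carrier G" "card T \<le> m"
  shows "\<exists>Y. finite Y \<and> Y \<subseteq> carrier G \<and> Y \<inter> H = {} \<and> card Y \<le> (card T)\<^sup>2 \<and>
    (\<forall>y\<in>Y. card (right_pattern H Y y) \<le> card T) \<and> inj_on (right_pattern H Y) Y \<and>
    T \<subseteq> generate G (Y \<union> H) \<and>
    ((\<forall>t\<in>T. \<not> coinvolution x t) \<longrightarrow> bigon_free Y)"
  using T
proof (induction T rule: finite_induct)
  case empty
  then show ?case by (intro exI[of _ "{}"]) (auto simp: bigon_free_def)
next
  case (insert t T)
  then have "T \<subseteq> carrier G" "card T \<le> m" by auto
  from insert.IH[OF this] obtain Y where Y: "finite Y" "Y \<subseteq> carrier G" "Y \<inter> H = {}" "card Y \<le> (card T)\<^sup>2"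
    "\<And>y. y \<in> Y \<Longrightarrow> card (right_pattern H Y y) \<le> card T" "inj_on (right_pattern H Y) Y"
    "T \<subseteq> generate G (Y \<union> H)"
    "\<forall>t\<in>T. \<not> coinvolution x t \<Longrightarrow> bigon_free Y"
    by blast
  have t: "t \<in> carrier G" using insert by auto
  have sub: "H \<subseteq> carrier G" using H by (simp add: subgroup.subset)
  show ?case
  proof (cases "t \<in> generate G (Y \<union> H)")
    case True
    have "card Y \<le> (card (insert t T))\<^sup>2"
      using Y(4) insert.hyps by (simp add: power2_eq_square)
    then show ?thesis
      using Y True insert.hyps by (intro exI[of _ Y]) (auto intro: le_SucI)
  next
    case False
    let ?n = "card T + 1"
    have nm: "?n \<le> m" using insert by simp
    have "(card T + 1)\<^sup>2 \<le> m\<^sup>2" using nm by (rule power_mono) simp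
    then have cY: "card Y + 2 * card T + 1 \<le> m\<^sup>2" using Y(4) by (simp add: power2_eq_square)
    \<comment> \<open>\<open>2 * ?L\<close> is the range in which the powers of \<open>x\<close> are
      known to be nontrivial, as distinct patterns within a block require.\<close>
    let ?L = "2 * m\<^sup>2 + 1"
    have "\<exists>B. B \<subseteq> (\<lambda>j::nat. t \<otimes> x [^] j) ` {..?L} \<and> card B = ?n \<and>
      (bigon_free Y \<and> \<not> coinvolution x t \<longrightarrow> bigon_free (Y \<union> B))"
      using cY by (intro ex_block x ord t Y) auto
    then obtain B where B: "B \<subseteq> (\<lambda>j::nat. t \<otimes> x [^] j) ` {..?L}" "card B = ?n"
      "bigon_free Y \<Longrightarrow> \<not> coinvolution x t \<Longrightarrow> bigon_free (Y \<union> B)" by blast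
    have fB: "finite B" using B(1) by (rule finite_subset) auto
    have cB: "B \<subseteq> carrier G" using B(1) x t by auto
    have xH: "x [^] (k::nat) \<in> H" for k
      using H by (induction k) (auto intro: subgroup.m_closed subgroup.one_closed)
    have BtH: "\<exists>h\<in>H. b = t \<otimes> h" if "b \<in> B" for b using that B(1) xH by auto
    have gen: "Y \<subseteq> generate G (Y \<union> H)" "H \<subseteq> generate G (Y \<union> H)"
      by (auto intro: generate.incl)
    have gsub: "subgroup (generate G (Y \<union> H)) G"
      using Y sub by (intro generate_is_subgroup) auto
    \<comment> \<open>Since \<open>t\<close> is outside the subgroup generated by
      \<open>Y \<union> H\<close>, so is the whole coset \<open>t H\<close>. The new block shares no
      coset with \<open>Y\<close>, and neither affects the patterns of the other.\<close>
    have bH: "b \<otimes> h \<notin> generate G (Y \<union> H)" if "b \<in> B" "h \<in> H" for b h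
    proof
      assume *: "b \<otimes> h \<in> generate G (Y \<union> H)"
      from BtH[OF that(1)] obtain k where k: "k \<in> H" "b = t \<otimes> k" by blast
      have c: "h \<in> carrier G" "k \<in> carrier G" using that k sub by auto
      have "inv (k \<otimes> h) \<in> generate G (Y \<union> H)"
        using gen that k H(1) by (meson subgroup.m_closed subgroup.m_inv_closed subsetD)
      with * have "(b \<otimes> h) \<otimes> inv (k \<otimes> h) \<in> generate G (Y \<union> H)"
        by (rule subgroup.m_closed[OF gsub])
      moreover have "(b \<otimes> h) \<otimes> inv (k \<otimes> h) = t"
        using c t by (simp add: k m_assoc inv_solve_right')
      ultimately show False using False by simp
    qed
    have BY: "b \<otimes> h \<notin> Y" if "b \<in> B" "h \<in> H" for b h using bH that gen by blast
    have YB: "y \<otimes> h \<notin> B" if "y \<in> Y" "h \<in> H" for y h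
    proof
      assume *: "y \<otimes> h \<in> B"
      have "y \<otimes> h \<otimes> inv h \<in> Y" using that Y sub by (simp add: m_assoc subset_eq)
      then show False using BY[OF *, of "inv h"] that H by (simp add: subgroup.m_inv_closed)
    qed
    have BH: "B \<inter> H = {}" using bH[of _ \<one>] gen H cB
      by (metis disjoint_iff r_one subgroup.one_closed subsetD)
    have pY: "right_pattern H (Y \<union> B) y = right_pattern H Y y" if "y \<in> Y" for y
      using that YB by (auto simp: right_pattern_def)
    have pB: "right_pattern H (Y \<union> B) b = right_pattern H B b" if "b \<in> B" for b
      using that BY by (auto simp: right_pattern_def)
    \<comment> \<open>\<open>B\<close> lies in one coset of \<open>H\<close>, so the pattern at
      \<open>b\<close> is a translate of all of \<open>B\<close>.\<close>
    have cpB: "card (right_pattern H B b) = ?n" if b: "b \<in> B" for b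
    proof -
      obtain k where k: "k \<in> H" "b = t \<otimes> k" using BtH b by blast
      have "(\<lambda>h. b \<otimes> h) ` right_pattern H B b = B"
      proof
        show "B \<subseteq> (\<lambda>h. b \<otimes> h) ` right_pattern H B b"
        proof
          fix b' assume b': "b' \<in> B"
          then obtain k' where k': "k' \<in> H" "b' = t \<otimes> k'" using BtH by blast
          have c: "k \<in> carrier G" "k' \<in> carrier G" using k k' sub by auto
          have "k \<otimes> (inv k \<otimes> k') = k'" using c by (simp flip: m_assoc)
          then have "b \<otimes> (inv k \<otimes> k') = b'" using c t by (simp add: k(2) k'(2) m_assoc)
          moreover have "inv k \<otimes> k' \<in> H"
            using subgroup.m_closed[OF H(1) subgroup.m_inv_closed[OF H(1) k(1)] k'(1)] .
          ultimately show "b' \<in> (\<lambda>h. b \<otimes> h) ` right_pattern H B b"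
            using b' by (intro image_eqI[where x = "inv k \<otimes> k'"]) (auto simp: right_pattern_def)
        qed
      qed (auto simp: right_pattern_def)
      moreover have "inj_on (\<lambda>h. b \<otimes> h) (right_pattern H B b)"
        using b cB sub by (auto simp: inj_on_def right_pattern_def subset_eq)
      ultimately show ?thesis using B(2) card_image by fastforce
    qed
    have iB: "inj_on (right_pattern H B) B"
      using ord by (intro inj_on_right_pattern_block[OF x _ t B(1) xH]) auto
    have "inj_on (right_pattern H (Y \<union> B)) (Y \<union> B)"
    proof (subst inj_on_Un, intro conjI)
      show "inj_on (right_pattern H (Y \<union> B)) Y" using Y(6) pY by (auto simp: inj_on_def)
      show "inj_on (right_pattern H (Y \<union> B)) B" using iB pB by (auto simp: inj_on_def)
      have "right_pattern H (Y \<union> B) y \<noteq> right_pattern H (Y \<union> B) b" if "y \<in> Y" "b \<in> B" for y b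
        using that pY pB cpB Y(5) by (metis Suc_eq_plus1 not_less_eq_eq order_refl)
      then show "right_pattern H (Y \<union> B) ` (Y - B) \<inter> right_pattern H (Y \<union> B) ` (B - Y) = {}"
        by auto
    qed
    moreover have "card (Y \<union> B) \<le> (card (insert t T))\<^sup>2"
      using card_Un_le[of Y B] B(2) Y(4) insert.hyps by (simp add: power2_eq_square)
    moreover have "\<forall>y\<in>Y \<union> B. card (right_pattern H (Y \<union> B) y) \<le> card (insert t T)"
      using pY pB cpB Y(5) insert.hyps by (auto intro: le_SucI)
    moreover have "insert t T \<subseteq> generate G ((Y \<union> B) \<union> H)"
    proof -
      have "generate G (Y \<union> H) \<subseteq> generate G ((Y \<union> B) \<union> H)" by (rule mono_generate) auto
      moreover have "t \<in> generate G ((Y \<union> B) \<union> H)"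
      proof -
        obtain b where b: "b \<in> B" using B(2) by fastforce
        then obtain k where k: "k \<in> H" "b = t \<otimes> k" using BtH by blast
        then have "b \<otimes> inv k \<in> generate G ((Y \<union> B) \<union> H)"
          using b H by (intro generate.eng generate.incl) (auto simp: subgroup.m_inv_closed)
        moreover have "b \<otimes> inv k = t" using k t sub by (auto simp: m_assoc)
        ultimately show ?thesis by simp
      qed
      ultimately show ?thesis using Y(7) by blast
    qed
    moreover have "bigon_free (Y \<union> B)" if "\<forall>u\<in>insert t T. \<not> coinvolution x u"
      using that Y(8) B(3) by auto
    moreover have "finite (Y \<union> B)" "Y \<union> B \<subseteq> carrier G" "(Y \<union> B) \<inter> H = {}"
      using Y(1-3) fB cB BH by auto
    ultimately show ?thesis
      by (intro exI[of _ "Y \<union> B"] conjI impI) assumption+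
  qed
qed

end


section \<open>Triangles\<close>

lemma card_Collect_bij:
  assumes "bij_betw f V V'" "\<And>w. w \<in> V \<Longrightarrow> P w \<longleftrightarrow> Q (f w)"
  shows "card {w \<in> V. P w} = card {w \<in> V'. Q w}"
proof (rule bij_betw_same_card)
  have "f ` {w \<in> V. P w} = {w \<in> V'. Q w}"
    using assms by (auto simp: bij_betw_def)
  then show "bij_betw f {w \<in> V. P w} {w \<in> V'. Q w}"
    using assms(1) by (auto simp: bij_betw_def inj_on_def)
qed

context group
begin

lemma cayley_arc_iff:
  assumes "S \<subseteq> carrier G" "g \<in> carrier G" "h \<in> carrier G"
  shows "(g, h) \<in> parcs (cayley_digraph G S) \<longleftrightarrow> inv g \<otimes> h \<in> S"
proof
  assume "(g, h) \<in> parcs (cayley_digraph G S)"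
  then obtain s where s: "s \<in> S" "h = g \<otimes> s" by (auto simp: cayley_digraph_def)
  then have "inv g \<otimes> h = s" using assms by (auto simp flip: m_assoc)
  then show "inv g \<otimes> h \<in> S" using s by simp
next
  assume *: "inv g \<otimes> h \<in> S"
  have "h = g \<otimes> (inv g \<otimes> h)" using assms by (simp flip: m_assoc)
  with * show "(g, h) \<in> parcs (cayley_digraph G S)" using assms by (auto simp: cayley_digraph_def)
qed

text \<open>For the arc from 1 to \<open>s\<close>, the first summand counts the paths of length two
  parallel to it, the second the common out-neighbours of its ends.\<close>

definition triangles :: "'a set \<Rightarrow> 'a \<Rightarrow> nat" where
  "triangles S s = card {a \<in> S. inv a \<otimes> s \<in> S} + card {a \<in> S. inv s \<otimes> a \<in> S}"

text \<open>Left translation by \<open>g\<close> turns labels into vertices. The right-hand side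
  refers only to the arc set and the ends of the arc, hence is preserved by automorphisms.\<close>

lemma triangles_eq:
  assumes S: "S \<subseteq> carrier G" and g: "g \<in> carrier G" and s: "s \<in> carrier G"
  defines "A \<equiv> parcs (cayley_digraph G S)"
  shows "triangles S s = card {w \<in> carrier G. (g, w) \<in> A \<and> (w, g \<otimes> s) \<in> A}
    + card {w \<in> carrier G. (g, w) \<in> A \<and> (g \<otimes> s, w) \<in> A}"
proof -
  have bij: "bij_betw (\<lambda>w. g \<otimes> w) (carrier G) (carrier G)"
    using g by (intro bij_betwI[of _ _ _ "\<lambda>w. inv g \<otimes> w"]) (auto simp flip: m_assoc)
  have arcs: "(g, g \<otimes> a) \<in> A \<longleftrightarrow> a \<in> S" "(g \<otimes> a, g \<otimes> b) \<in> A \<longleftrightarrow> inv a \<otimes> b \<in> S"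
    if "a \<in> carrier G" "b \<in> carrier G" for a b
  proof -
    have "inv g \<otimes> (g \<otimes> a) = a" "inv (g \<otimes> a) \<otimes> (g \<otimes> b) = inv a \<otimes> b"
      using g that by (simp_all add: inv_mult_group m_assoc flip: m_assoc[of "inv g" g])
    then show "(g, g \<otimes> a) \<in> A \<longleftrightarrow> a \<in> S" "(g \<otimes> a, g \<otimes> b) \<in> A \<longleftrightarrow> inv a \<otimes> b \<in> S"
      using g that cayley_arc_iff[OF S] by (simp_all add: A_def)
  qed
  have "{a \<in> S. P a} = {a \<in> carrier G. a \<in> S \<and> P a}" for P using S by auto
  then show ?thesis
    unfolding triangles_def
    by (simp add: card_Collect_bij[OF bij, of "\<lambda>a. a \<in> S \<and> inv a \<otimes> s \<in> S"
          "\<lambda>w. (g, w) \<in> A \<and> (w, g \<otimes> s) \<in> A"]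
        card_Collect_bij[OF bij, of "\<lambda>a. a \<in> S \<and> inv s \<otimes> a \<in> S"
          "\<lambda>w. (g, w) \<in> A \<and> (g \<otimes> s, w) \<in> A"]
        arcs s)
qed

lemma triangles_automorphism:
  assumes S: "S \<subseteq> carrier G" and \<phi>: "\<phi> \<in> digraph_automorphisms (cayley_digraph G S)"
    and g: "g \<in> carrier G" and s: "s \<in> carrier G" "s' \<in> carrier G" "\<phi> (g \<otimes> s) = \<phi> g \<otimes> s'"
  shows "triangles S s' = triangles S s"
proof -
  let ?A = "parcs (cayley_digraph G S)"
  have bij: "bij_betw \<phi> (carrier G) (carrier G)"
    and arcs: "\<And>a b. a \<in> carrier G \<Longrightarrow> b \<in> carrier G \<Longrightarrow> (a, b) \<in> ?A \<longleftrightarrow> (\<phi> a, \<phi> b) \<in> ?A"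
    using \<phi> by (auto simp: digraph_automorphisms_def Bij_def cayley_digraph_def)
  have \<phi>g: "\<phi> g \<in> carrier G" using bij g by (rule bij_betwE[THEN bspec])
  have gs: "g \<otimes> s \<in> carrier G" using g s by simp
  show ?thesis
    unfolding triangles_eq[OF S g s(1)] triangles_eq[OF S \<phi>g s(2)] s(3)[symmetric]
    using card_Collect_bij[OF bij, of "\<lambda>w. (g, w) \<in> ?A \<and> (w, g \<otimes> s) \<in> ?A"
        "\<lambda>w. (\<phi> g, w) \<in> ?A \<and> (w, \<phi> (g \<otimes> s)) \<in> ?A"]
      card_Collect_bij[OF bij, of "\<lambda>w. (g, w) \<in> ?A \<and> (g \<otimes> s, w) \<in> ?A"
        "\<lambda>w. (\<phi> g, w) \<in> ?A \<and> (\<phi> (g \<otimes> s), w) \<in> ?A"] arcs[OF g] arcs[OF gs] arcs[OF _ gs]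
    by simp
qed

text \<open>Products and quotients of elements of \<open>P\<close> stay in \<open>H\<close>, so a
  triangle on an arc labelled \<open>y\<close> has another side with label in \<open>Y\<close>. Each
  count is at most \<open>2 * card Y\<close>: either \<open>a\<close> is in \<open>Y\<close>, or it
  is determined by the other label, which is.\<close>

lemma triangles_le:
  assumes H: "subgroup H G" "P \<subseteq> H" and Y: "finite Y" "Y \<subseteq> carrier G" "Y \<inter> H = {}" and y: "y \<in> Y"
  shows "triangles (P \<union> Y) y \<le> 4 * card Y"
proof -
  have P: "P \<subseteq> carrier G" using H subgroup.subset by blast
  have y': "y \<in> carrier G" "y \<notin> H" using y Y by auto
  have XX: "a \<otimes> b \<noteq> y" "a \<otimes> inv b \<noteq> y" if "a \<in> P" "b \<in> P" for a b
    using that y' H by (metis subgroup.m_closed subgroup.m_inv_closed subsetD)+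
  have "{a \<in> P \<union> Y. inv a \<otimes> y \<in> P \<union> Y} \<subseteq> Y \<union> (\<lambda>b. y \<otimes> inv b) ` Y"
  proof
    fix a assume a: "a \<in> {a \<in> P \<union> Y. inv a \<otimes> y \<in> P \<union> Y}"
    define b where "b = inv a \<otimes> y"
    have ab: "a \<in> carrier G" "b \<in> carrier G" "a \<otimes> b = y" "b \<in> P \<union> Y"
      using a P Y y' by (auto simp: b_def simp flip: m_assoc)
    have "a = y \<otimes> inv b" using ab y' by (metis inv_solve_right)
    then show "a \<in> Y \<union> (\<lambda>b. y \<otimes> inv b) ` Y" using XX(1) ab a by blast
  qed
  then have "card {a \<in> P \<union> Y. inv a \<otimes> y \<in> P \<union> Y} \<le> card (Y \<union> (\<lambda>b. y \<otimes> inv b) ` Y)"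
    using Y by (intro card_mono) auto
  also have "\<dots> \<le> card Y + card Y"
    using Y by (intro card_Un_le[THEN order_trans] add_mono card_image_le) auto
  finally have 1: "card {a \<in> P \<union> Y. inv a \<otimes> y \<in> P \<union> Y} \<le> card Y + card Y" .
  have "{a \<in> P \<union> Y. inv y \<otimes> a \<in> P \<union> Y} \<subseteq> Y \<union> (\<lambda>b. y \<otimes> b) ` Y"
  proof
    fix a assume a: "a \<in> {a \<in> P \<union> Y. inv y \<otimes> a \<in> P \<union> Y}"
    define b where "b = inv y \<otimes> a"
    have ab: "a \<in> carrier G" "b \<in> carrier G" "a = y \<otimes> b" "b \<in> P \<union> Y"
      using a P Y y' by (auto simp: b_def simp flip: m_assoc)
    then have "a \<otimes> inv b = y" using y' by (simp add: m_assoc)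
    then show "a \<in> Y \<union> (\<lambda>b. y \<otimes> b) ` Y" using XX(2) ab a by blast
  qed
  then have "card {a \<in> P \<union> Y. inv y \<otimes> a \<in> P \<union> Y} \<le> card (Y \<union> (\<lambda>b. y \<otimes> b) ` Y)"
    using Y by (intro card_mono) auto
  also have "\<dots> \<le> card Y + card Y"
    using Y by (intro card_Un_le[THEN order_trans] add_mono card_image_le) auto
  finally show ?thesis using 1 by (simp add: triangles_def)
qed

text \<open>\<open>x^k\<close> splits as \<open>x^i x^(k-i)\<close> in \<open>k - 1\<close> ways and
  is a first factor of some \<open>x^i\<close> in \<open>M - k\<close> ways. The sum does not depend
  on \<open>k\<close>, which is why the two counts are added.\<close>

lemma triangles_ge:
  assumes x: "x \<in> carrier G" and ord: "\<And>k. 0 < k \<Longrightarrow> k \<le> M \<Longrightarrow> x [^] k \<noteq> \<one>"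
    and S: "finite S" "\<And>i. 0 < i \<Longrightarrow> i \<le> M \<Longrightarrow> x [^] i \<in> S" and k: "0 < k" "k \<le> M"
  shows "M - 1 \<le> triangles S (x [^] (k::nat))"
proof -
  have minus: "inv (x [^] i) \<otimes> x [^] j = x [^] (j - i)" if "i \<le> j" for i j :: nat
    using x that by (simp add: inv_solve_left' nat_pow_mult)
  have inj: "inj_on (\<lambda>i::nat. x [^] i) {..M}" by (rule inj_on_pow[OF x ord])
  have "(\<lambda>i. x [^] i) ` {0<..<k} \<subseteq> {a \<in> S. inv a \<otimes> x [^] k \<in> S}"
    using S(2) k by (auto simp: minus)
  then have "card ((\<lambda>i. x [^] i) ` {0<..<k}) \<le> card {a \<in> S. inv a \<otimes> x [^] k \<in> S}"
    using S(1) by (intro card_mono) auto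
  moreover have "card ((\<lambda>i. x [^] i) ` {0<..<k}) = k - 1"
    using k by (subst card_image[OF inj_on_subset[OF inj]]) auto
  moreover have "(\<lambda>i. x [^] i) ` {k<..M} \<subseteq> {a \<in> S. inv (x [^] k) \<otimes> a \<in> S}"
    using S(2) k by (auto simp: minus)
  then have "card ((\<lambda>i. x [^] i) ` {k<..M}) \<le> card {a \<in> S. inv (x [^] k) \<otimes> a \<in> S}"
    using S(1) by (intro card_mono) auto
  moreover have "card ((\<lambda>i. x [^] i) ` {k<..M}) = M - k"
    using k by (subst card_image[OF inj_on_subset[OF inj]]) auto
  ultimately show ?thesis using k by (simp add: triangles_def)
qed


section \<open>Rigidity\<close>

lemma automorphism_is_left_multiplication:
  assumes x: "x \<in> carrier G" and ord: "\<And>k. 0 < k \<Longrightarrow> k \<le> 2 * M \<Longrightarrow> x [^] k \<noteq> \<one>"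
    and H: "H = generate G {x}"
    and Y: "finite Y" "Y \<subseteq> carrier G" "Y \<inter> H = {}" "inj_on (right_pattern H Y) Y"
      "4 * card Y + 1 < M"
    and S: "S = (\<lambda>k. x [^] (k::nat)) ` {1..M} \<union> Y" "generate G S = carrier G"
    and \<phi>: "\<phi> \<in> digraph_automorphisms (cayley_digraph G S)"
  shows "\<phi> \<in> left_multiplications G"
proof -
  let ?A = "parcs (cayley_digraph G S)"
  let ?X = "(\<lambda>k. x [^] (k::nat)) ` {1..M}"
  have bij: "bij_betw \<phi> (carrier G) (carrier G)" and ext: "\<phi> \<in> extensional (carrier G)"
    and arcs: "\<And>a b. a \<in> carrier G \<Longrightarrow> b \<in> carrier G \<Longrightarrow> (a, b) \<in> ?A \<longleftrightarrow> (\<phi> a, \<phi> b) \<in> ?A"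
    using \<phi> by (auto simp: digraph_automorphisms_def Bij_def cayley_digraph_def)
  have \<phi>V[simp, intro]: "\<phi> g \<in> carrier G" if "g \<in> carrier G" for g
    using bij that by (rule bij_betwE[THEN bspec])
  have inj: "g = h" if "g \<in> carrier G" "h \<in> carrier G" "\<phi> g = \<phi> h" for g h
    using bij that by (auto simp: bij_betw_def inj_on_def)
  have subH: "subgroup H G" using x H generate_is_subgroup by simp
  have HV: "H \<subseteq> carrier G" using subH by (rule subgroup.subset)
  have xH: "x \<in> H" by (simp add: H generate.incl)
  have powH: "x [^] (k::nat) \<in> H" for k
    using subH xH by (induction k) (auto intro: subgroup.m_closed subgroup.one_closed)
  have SV: "S \<subseteq> carrier G" using S x Y by auto
  have arc: "(g, g \<otimes> s) \<in> ?A \<longleftrightarrow> s \<in> S" if "g \<in> carrier G" "s \<in> carrier G" for g s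
    using that cayley_arc_iff[OF SV, of g "g \<otimes> s"] by (simp flip: m_assoc)
  have image: "\<exists>s'\<in>S. \<phi> (g \<otimes> s) = \<phi> g \<otimes> s'" if "g \<in> carrier G" "s \<in> S" for g s
  proof -
    have s: "s \<in> carrier G" using that SV by auto
    have "(\<phi> g, \<phi> (g \<otimes> s)) \<in> ?A" using arc arcs[of g "g \<otimes> s"] that s by simp
    then have "inv (\<phi> g) \<otimes> \<phi> (g \<otimes> s) \<in> S" using cayley_arc_iff[OF SV] that s by simp
    moreover have "\<phi> (g \<otimes> s) = \<phi> g \<otimes> (inv (\<phi> g) \<otimes> \<phi> (g \<otimes> s))"
      using that s by (simp flip: m_assoc)
    ultimately show ?thesis by blast
  qed
  \<comment> \<open>\<open>M - 1\<close> exceeds \<open>4 * card Y\<close>, so this threshold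
    separates the power labels from those in \<open>Y\<close>.\<close>
  have tri: "s \<in> ?X \<longleftrightarrow> 4 * card Y < triangles S s" if "s \<in> S" for s
  proof
    assume "s \<in> ?X"
    then obtain k where k: "s = x [^] k" "0 < k" "k \<le> M" by auto
    have "M - 1 \<le> triangles S s"
      unfolding k(1) using ord S(1) Y(1) k(2,3) by (intro triangles_ge[OF x]) auto
    then show "4 * card Y < triangles S s" using Y(5) by linarith
  next
    assume *: "4 * card Y < triangles S s"
    have "triangles S s \<le> 4 * card Y" if "s \<in> Y"
      unfolding S(1) using powH by (intro triangles_le[OF subH _ Y(1-3) that]) auto
    then show "s \<in> ?X" using * that S(1) by auto
  qed
  have type: "s \<in> ?X \<longleftrightarrow> s' \<in> ?X" if "g \<in> carrier G" "s \<in> S" "s' \<in> S" "\<phi> (g \<otimes> s) = \<phi> g \<otimes> s'" for g s s'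
    using tri that triangles_automorphism[OF SV \<phi>, of g s s'] SV by (simp add: subset_eq)
  have M: "1 \<le> M" using Y(5) by simp
  \<comment> \<open>If \<open>x\<close> became \<open>x^l\<close> with \<open>l > 1\<close>, the
    path from \<open>\<phi> g\<close> through \<open>\<phi> g x\<close> to
    \<open>\<phi> g x^l\<close> would pull back to a path from \<open>g\<close> to
    \<open>g x\<close> with two power labels. This gives \<open>x^(i + j) = x\<close> with
    \<open>i, j \<ge> 1\<close>, against the order of \<open>x\<close>.\<close>
  have \<phi>x: "\<phi> (g \<otimes> x) = \<phi> g \<otimes> x" if g: "g \<in> carrier G" for g
  proof -
    have xX: "x \<in> ?X" using M x by (intro image_eqI[where x = 1]) auto
    then obtain s where s: "s \<in> S" "\<phi> (g \<otimes> x) = \<phi> g \<otimes> s" using image[OF g, of x] S by auto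
    then have "s \<in> ?X" using type[OF g _ s] xX S by auto
    then obtain l where l: "s = x [^] l" "1 \<le> l" "l \<le> M" by auto
    show ?thesis
    proof (cases "l = 1")
      case True
      then show ?thesis using s l x by simp
    next
      case False
      have "\<phi> g \<otimes> x \<in> carrier G" using g x by simp
      then obtain w where w: "w \<in> carrier G" "\<phi> w = \<phi> g \<otimes> x"
        using bij by (metis bij_betw_imp_surj_on imageE)
      have xS: "x \<in> S" using xX S by auto
      have "(\<phi> g, \<phi> w) \<in> ?A" using w g x xS arc by simp
      then have "(g, w) \<in> ?A" using arcs g w by simp
      then have a: "inv g \<otimes> w \<in> S" using cayley_arc_iff[OF SV] g w by simp
      have ga: "g \<otimes> (inv g \<otimes> w) = w" using g w by (simp flip: m_assoc)
      have aX: "inv g \<otimes> w \<in> ?X" using type[OF g a xS] w ga xX by simp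
      have "x [^] (l - 1) \<in> ?X" using l False by (intro imageI) auto
      then have lS: "x [^] (l - 1) \<in> S" "x [^] (l - 1) \<in> ?X" using S(1) by auto
      have "x \<otimes> x [^] (l - 1) = s"
        using l x nat_pow_mult[of x 1 "l - 1"] by simp
      then have wl: "\<phi> w \<otimes> x [^] (l - 1) = \<phi> (g \<otimes> x)" using w s g x by (simp add: m_assoc)
      then have "(\<phi> w, \<phi> (g \<otimes> x)) \<in> ?A" using arc[of "\<phi> w" "x [^] (l - 1)"] w g x lS by simp
      then have "(w, g \<otimes> x) \<in> ?A" using arcs[of w "g \<otimes> x"] g w x by simp
      then have b: "inv w \<otimes> (g \<otimes> x) \<in> S" using cayley_arc_iff[OF SV] g w x by simp
      have wb: "w \<otimes> (inv w \<otimes> (g \<otimes> x)) = g \<otimes> x" using g w x by (simp flip: m_assoc)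
      have bX: "inv w \<otimes> (g \<otimes> x) \<in> ?X" using type[OF w(1) b lS(1)] wl wb lS by simp
      obtain i where i: "inv g \<otimes> w = x [^] i" "1 \<le> i" "i \<le> M" using aX by auto
      obtain j where j: "inv w \<otimes> (g \<otimes> x) = x [^] j" "1 \<le> j" "j \<le> M" using bX by auto
      have "g \<otimes> x [^] (i + j) = g \<otimes> x"
        using ga wb i j g x by (simp add: nat_pow_mult[symmetric] m_assoc[symmetric])
      then have "x [^] (i + j) = x [^] (1::nat)" using g x by simp
      then have "x [^] (i + j - 1) = \<one>" using i j x by (intro pow_minus_eq_one) auto
      moreover have "0 < i + j - 1" "i + j - 1 \<le> 2 * M" using i j by linarith+
      ultimately show ?thesis using ord by blast
    qed
  qed
  \<comment> \<open>Being a subgroup, this is everything once it contains \<open>S\<close>.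
    Containing \<open>x\<close>, it contains \<open>H\<close>, which makes the patterns available
    for the labels in \<open>Y\<close>.\<close>
  let ?K = "{s \<in> carrier G. \<forall>g\<in>carrier G. \<phi> (g \<otimes> s) = \<phi> g \<otimes> s}"
  have K: "subgroup ?K G"
  proof (rule subgroupI)
    show "?K \<noteq> {}" using \<phi>V by (auto intro!: exI[of _ \<one>])
    fix a assume a: "a \<in> ?K"
    have "\<phi> (g \<otimes> inv a) = \<phi> g \<otimes> inv a" if g: "g \<in> carrier G" for g
    proof -
      have "\<phi> (g \<otimes> inv a \<otimes> a) = \<phi> (g \<otimes> inv a) \<otimes> a" using a g by simp
      then have "\<phi> g = \<phi> (g \<otimes> inv a) \<otimes> a" using a g by (simp add: m_assoc)
      then show ?thesis using a g by (simp add: m_assoc)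
    qed
    then show "inv a \<in> ?K" using a by simp
    fix b assume b: "b \<in> ?K"
    have "\<phi> (g \<otimes> (a \<otimes> b)) = \<phi> g \<otimes> (a \<otimes> b)" if g: "g \<in> carrier G" for g
    proof -
      have "\<phi> (g \<otimes> a \<otimes> b) = \<phi> g \<otimes> a \<otimes> b" using a b g by simp
      then show ?thesis using a b g by (simp add: m_assoc)
    qed
    then show "a \<otimes> b \<in> ?K" using a b by simp
  qed auto
  have xK: "x \<in> ?K" using \<phi>x x by simp
  have "H \<subseteq> ?K" unfolding H using xK by (intro generate_subgroup_incl[OF _ K]) simp
  then have \<phi>H: "\<phi> (g \<otimes> h) = \<phi> g \<otimes> h" if "g \<in> carrier G" "h \<in> H" for g h using that by blast
  have "\<phi> (g \<otimes> y) = \<phi> g \<otimes> y" if g: "g \<in> carrier G" and y: "y \<in> Y" for g y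
  proof -
    have yS: "y \<in> S" "y \<in> carrier G" "y \<notin> H" using y S(1) Y by auto
    obtain y' where y': "y' \<in> S" "\<phi> (g \<otimes> y) = \<phi> g \<otimes> y'" using image[OF g yS(1)] by blast
    have y'V: "y' \<in> carrier G" using y' SV by auto
    have "y' \<notin> H"
    proof
      assume "y' \<in> H"
      then have "\<phi> (g \<otimes> y) = \<phi> (g \<otimes> y')" using \<phi>H g y' by simp
      then have "g \<otimes> y = g \<otimes> y'" using inj g yS y'V by simp
      then show False using g yS y'V \<open>y' \<in> H\<close> by simp
    qed
    then have y'Y: "y' \<in> Y" using y' S(1) powH by auto
    \<comment> \<open>Arcs detect \<open>S\<close>, whereas patterns refer to \<open>Y\<close>. The
      two agree on the coset \<open>z H\<close>, which misses \<open>H\<close> and with it the power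
      labels.\<close>
    have SY: "z \<otimes> h \<in> S \<longleftrightarrow> z \<otimes> h \<in> Y" if "z \<in> Y" "h \<in> H" for z h
    proof -
      have "z \<otimes> h \<notin> H"
      proof
        assume "z \<otimes> h \<in> H"
        then have "z \<otimes> h \<otimes> inv h \<in> H"
          using that subH by (simp add: subgroup.m_closed subgroup.m_inv_closed)
        moreover have "z \<otimes> h \<otimes> inv h = z" using that Y HV by (simp add: m_assoc subset_eq)
        ultimately show False using that Y by auto
      qed
      then show ?thesis using S(1) powH by auto
    qed
    have "y \<otimes> h \<in> Y \<longleftrightarrow> y' \<otimes> h \<in> Y" if h: "h \<in> H" for h
    proof -
      have hV: "h \<in> carrier G" using h HV by auto
      have "\<phi> (g \<otimes> (y \<otimes> h)) = \<phi> (g \<otimes> y) \<otimes> h"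
        using \<phi>H[of "g \<otimes> y" h] g yS h hV by (simp add: m_assoc)
      also have "\<dots> = \<phi> g \<otimes> (y' \<otimes> h)" using y' g y'V hV by (simp add: m_assoc)
      finally have "(g, g \<otimes> (y \<otimes> h)) \<in> ?A \<longleftrightarrow> (\<phi> g, \<phi> g \<otimes> (y' \<otimes> h)) \<in> ?A"
        using arcs[of g "g \<otimes> (y \<otimes> h)"] g yS hV by simp
      then have "y \<otimes> h \<in> S \<longleftrightarrow> y' \<otimes> h \<in> S" using arc g yS y'V hV by simp
      then show ?thesis using SY y y'Y h by simp
    qed
    then have "right_pattern H Y y = right_pattern H Y y'" by (auto simp: right_pattern_def)
    then have "y = y'" using Y(4) y y'Y by (auto dest: inj_onD)
    then show ?thesis using y' by simp
  qed
  then have "Y \<subseteq> ?K" using Y by auto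
  moreover have "?X \<subseteq> ?K" using powH \<open>H \<subseteq> ?K\<close> by blast
  ultimately have "generate G S \<subseteq> ?K" unfolding S(1) by (intro generate_subgroup_incl[OF _ K]) simp
  then have \<phi>1: "\<phi> (\<one> \<otimes> g) = \<phi> \<one> \<otimes> g" if "g \<in> carrier G" for g using that S(2) by blast
  have "\<phi> = (\<lambda>g \<in> carrier G. \<phi> \<one> \<otimes> g)"
  proof (rule extensionalityI[OF ext])
    fix g assume g: "g \<in> carrier G"
    show "\<phi> g = (\<lambda>g \<in> carrier G. \<phi> \<one> \<otimes> g) g"
      unfolding restrict_apply'[OF g] using \<phi>1[OF g] unfolding l_one[OF g] .
  qed simp
  then show ?thesis unfolding left_multiplications_def using \<phi>V[of \<one>] by blast
qed

text \<open>Absence of bigons is stated conditionally, so that one construction serves both halves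
  of the theorem.\<close>

lemma ex_rigid_cayley_digraph:
  assumes x: "x \<in> carrier G" and ord: "\<And>k. 0 < k \<Longrightarrow> k \<le> 8 * m\<^sup>2 + 4 \<Longrightarrow> x [^] k \<noteq> \<one>"
    and T: "finite T" "T \<subseteq> carrier G" "card T \<le> m" "generate G (insert x T) = carrier G"
  shows "\<exists>D. is_cayley_digraph G D \<and> locally_finite D \<and>
    digraph_automorphisms D = left_multiplications G \<and>
    ((\<forall>t\<in>T. \<not> coinvolution x t) \<longrightarrow> (\<nexists>e. bigon D e))"
proof -
  define H where "H = generate G {x}"
  have H: "subgroup H G" "x \<in> H"
    using x generate_is_subgroup by (auto simp: H_def generate.incl)
  have powH: "x [^] (k::nat) \<in> H" for k
    using H by (induction k) (auto intro: subgroup.m_closed subgroup.one_closed)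
  have "\<exists>Y. finite Y \<and> Y \<subseteq> carrier G \<and> Y \<inter> H = {} \<and> card Y \<le> (card T)\<^sup>2 \<and>
    (\<forall>y\<in>Y. card (right_pattern H Y y) \<le> card T) \<and> inj_on (right_pattern H Y) Y \<and>
    T \<subseteq> generate G (Y \<union> H) \<and>
    ((\<forall>t\<in>T. \<not> coinvolution x t) \<longrightarrow> bigon_free Y)"
    using ord by (intro ex_rigid_set[OF x _ H T(1-3)]) auto
  then obtain Y where Y: "finite Y" "Y \<subseteq> carrier G" "Y \<inter> H = {}" "card Y \<le> (card T)\<^sup>2"
    "inj_on (right_pattern H Y) Y" "T \<subseteq> generate G (Y \<union> H)"
    "\<forall>t\<in>T. \<not> coinvolution x t \<Longrightarrow> bigon_free Y" by blast
  have "(card T)\<^sup>2 \<le> m\<^sup>2" using T(3) by (rule power_mono) simp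
  with Y(4) have cY: "card Y \<le> m\<^sup>2" by (rule order_trans)
  \<comment> \<open>Large enough for the triangle counts to separate the two kinds of labels, while
    \<open>2 * M\<close> is exactly the range of nontrivial powers of \<open>x\<close>.\<close>
  define M where "M = 4 * m\<^sup>2 + 2"
  have M: "4 * card Y + 1 < M" "2 * M = 8 * m\<^sup>2 + 4"
    using cY by (simp_all add: M_def)
  define S where "S = (\<lambda>k. x [^] (k::nat)) ` {1..M} \<union> Y"
  let ?D = "cayley_digraph G S"
  have S: "S \<subseteq> carrier G" "finite S" using x Y by (auto simp: S_def)
  \<comment> \<open>Mutually inverse labels lie both in \<open>H\<close> or both in
    \<open>Y\<close>, and two power labels multiply to \<open>x^(i + j)\<close> with
    \<open>i + j \<le> 2 * M\<close>. This gives \<open>\<one> \<notin> S\<close> as well as the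
    absence of bigons when \<open>Y\<close> is \<open>bigon_free\<close>.\<close>
  have free: "u \<otimes> v \<noteq> \<one>" if "u \<in> S" "v \<in> S" "u \<in> Y \<Longrightarrow> v \<in> Y \<Longrightarrow> u \<otimes> v \<noteq> \<one>" for u v
  proof
    assume uv: "u \<otimes> v = \<one>"
    have V: "u \<in> carrier G" "v \<in> carrier G" using that S by auto
    have "inv v = u" "inv u = v" using uv V by (metis inv_equality inv_inv)+
    then have "u \<in> H \<longleftrightarrow> v \<in> H" using H(1) by (metis subgroup.m_inv_closed)
    then have "u \<notin> Y \<and> v \<notin> Y" using that uv powH Y(3) by (auto simp: S_def)
    with that(1,2) obtain i j where "u = x [^] i" "v = x [^] j" "1 \<le> i" "i \<le> M" "1 \<le> j" "j \<le> M"
      by (auto simp: S_def)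
    then show False using uv x ord[of "i + j"] M(2) by (simp add: nat_pow_mult)
  qed
  have one: "\<one> \<notin> S"
  proof
    assume "\<one> \<in> S"
    then have "\<one> \<notin> Y" using Y(3) H(1) by (auto dest: subgroup.one_closed)
    then show False using free[of \<one> \<one>] \<open>\<one> \<in> S\<close> by simp
  qed
  have sub: "subgroup (generate G S) G" using S by (intro generate_is_subgroup)
  have "x \<in> S" using x by (auto simp: S_def M_def intro!: image_eqI[where x = 1])
  then have xS: "x \<in> generate G S" by (rule generate.incl)
  then have "H \<subseteq> generate G S" unfolding H_def by (intro generate_subgroup_incl[OF _ sub]) simp
  moreover have "Y \<subseteq> generate G S" by (auto simp: S_def intro: generate.incl)
  ultimately have "generate G (Y \<union> H) \<subseteq> generate G S"
    by (intro generate_subgroup_incl[OF _ sub]) simp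
  then have "carrier G \<subseteq> generate G S"
    unfolding T(4)[symmetric] using Y(6) xS by (intro generate_subgroup_incl[OF _ sub]) auto
  then have gen: "generate G S = carrier G" using sub by (auto dest: subgroup.subset)
  have cay: "is_cayley_digraph G ?D"
    using S gen one by (auto simp: is_cayley_digraph_def generating_set_def)
  have "digraph_automorphisms ?D \<subseteq> left_multiplications G"
    using automorphism_is_left_multiplication[OF x _ H_def Y(1-3,5) M(1) S_def gen] ord M(2) by auto
  then have "digraph_automorphisms ?D = left_multiplications G"
    using left_multiplications_subset_automorphisms[OF is_group cay] by blast
  moreover have "\<not> bigon ?D e" if "\<forall>t\<in>T. \<not> coinvolution x t" for e
  proof
    assume "bigon ?D e"
    moreover obtain g h where e: "e = (g, h)" by fastforce
    ultimately have arcs: "(g, h) \<in> parcs ?D" "(h, g) \<in> parcs ?D" by (auto simp: bigon_def)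
    then have V: "g \<in> carrier G" "h \<in> carrier G" by (auto simp: cayley_digraph_def)
    then have "inv g \<otimes> h \<in> S" "inv h \<otimes> g \<in> S" using arcs cayley_arc_iff[OF S(1)] by auto
    moreover have "inv g \<otimes> h \<otimes> (inv h \<otimes> g) = \<one>"
      using V by (metis inv_closed inv_solve_left l_inv m_assoc m_closed)
    ultimately show False using free Y(7)[OF that] unfolding bigon_free_def by blast
  qed
  ultimately show ?thesis
    using cay locally_finite_cayley_iff[OF is_group S(1)] S(2) by blast
qed

end

section \<open>Choice of the generators and comparison with the order bound\<close>

theorem theorem2:
  fixes G :: "('a, 'b) monoid_scheme"
  assumes "group G"
    and "finitely_generated G"
    and "\<exists>x \<in> carrier G. group.ord G x = 0 \<or> group.ord G x \<ge> (5 * group_rank G) ^ 12"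
  shows "(\<exists>D. is_cayley_digraph G D \<and> locally_finite D \<and>
              digraph_automorphisms D = left_multiplications G) \<and>
         (\<not> generalized_dihedral G \<longrightarrow>
            (\<exists>D. is_cayley_digraph G D \<and> locally_finite D \<and>
                 digraph_automorphisms D = left_multiplications G \<and> (\<nexists>e. bigon D e)))"
proof -
  interpret group G by fact
  define r where "r = group_rank G"
  have "\<exists>S. finite S \<and> generating_set G S \<and> card S = r"
    unfolding r_def group_rank_def
    by (rule LeastI_ex) (use assms(2) in \<open>auto simp: finitely_generated_def\<close>)
  then obtain S where S: "finite S" "S \<subseteq> carrier G" "generate G S = carrier G" "card S = r"
    by (auto simp: generating_set_def)
  show ?thesis
  proof (cases "r = 0")
    \<comment> \<open>Here \<open>(5 * r) ^ 12 = 0\<close>, so no element of large order is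
      available; but \<open>G\<close> is trivial and the empty set of labels works.\<close>
    case True
    then have triv: "carrier G = {\<one>\<^bsub>G\<^esub>}" "generate G {} = carrier G"
      using S generate_empty by auto
    let ?D = "cayley_digraph G {}"
    have cay: "is_cayley_digraph G ?D"
      using triv by (auto simp: is_cayley_digraph_def generating_set_def)
    have "\<phi> \<in> left_multiplications G" if "\<phi> \<in> digraph_automorphisms ?D" for \<phi>
    proof -
      have "\<phi> = (\<lambda>x \<in> carrier G. \<one>\<^bsub>G\<^esub> \<otimes>\<^bsub>G\<^esub> x)"
        using that triv(1)
        by (intro extensionalityI[of _ "carrier G"])
          (auto simp: digraph_automorphisms_def Bij_def cayley_digraph_def bij_betw_def)
      then show ?thesis by (auto simp: left_multiplications_def)
    qed
    then have "digraph_automorphisms ?D = left_multiplications G"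
      using left_multiplications_subset_automorphisms[OF assms(1) cay] by blast
    moreover have "locally_finite ?D" by (simp add: locally_finite_cayley_iff)
    moreover have "\<nexists>e. bigon ?D e" by (simp add: bigon_def cayley_digraph_def)
    ultimately show ?thesis using cay by blast
  next
    case False
    obtain x where x: "x \<in> carrier G" "ord x = 0 \<or> ord x \<ge> (5 * r) ^ 12"
      using assms(3) unfolding r_def by blast
    \<comment> \<open>The value \<open>2 * r\<close> for \<open>m\<close> allows each of the
      \<open>r\<close> generators to be replaced by two.\<close>
    have "8 * (2 * r)\<^sup>2 + 4 < (5 * r) ^ 12"
    proof -
      have r: "1 \<le> r\<^sup>2" using False by simp
      then have "8 * (2 * r)\<^sup>2 + 4 < 625 * (r\<^sup>2 * 1)" by (simp add: power_mult_distrib)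
      also have "\<dots> \<le> 625 * (r\<^sup>2 * r\<^sup>2)" using r by (intro mult_left_mono) auto
      also have "\<dots> = (5 * r) ^ 4" by (simp add: power_mult_distrib flip: power_add)
      also have "\<dots> \<le> (5 * r) ^ 12" using False by (intro power_increasing) auto
      finally show ?thesis .
    qed
    \<comment> \<open>\<open>ord x = 0\<close> encodes infinite order; as 0 divides no positive
      \<open>k\<close>, divisibility covers both cases.\<close>
    then have ord: "x [^]\<^bsub>G\<^esub> k \<noteq> \<one>\<^bsub>G\<^esub>" if "0 < k" "k \<le> 8 * (2 * r)\<^sup>2 + 4" for k
      using that x pow_eq_id[OF x(1), of k] by (auto dest: dvd_imp_le)
    have "generate G S \<subseteq> generate G (insert x S)" by (rule mono_generate) auto
    moreover have "generate G (insert x S) \<subseteq> carrier G" using S x by (intro generate_incl) auto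
    ultimately have gen: "generate G (insert x S) = carrier G" using S(3) by blast
    have "card S \<le> 2 * r" using S(4) by simp
    then have "\<exists>D. is_cayley_digraph G D \<and> locally_finite D \<and>
        digraph_automorphisms D = left_multiplications G"
      using ex_rigid_cayley_digraph[OF x(1) ord S(1,2) _ gen] by blast
    moreover have "\<exists>D. is_cayley_digraph G D \<and> locally_finite D \<and>
        digraph_automorphisms D = left_multiplications G \<and> (\<nexists>e. bigon D e)"
      if "\<not> generalized_dihedral G"
    proof -
      have xx: "x \<otimes>\<^bsub>G\<^esub> x \<noteq> \<one>\<^bsub>G\<^esub>" using ord[of 2] x by (simp add: numeral_2_eq_2)
      \<comment> \<open>A coinvolution \<open>s\<close> is replaced by \<open>g\<close> and
        \<open>s \<otimes> g\<close>, neither of which is one. Such a \<open>g\<close> exists, since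
        otherwise \<open>G\<close> would be generalized dihedral.\<close>
      have "\<exists>U. finite U \<and> card U \<le> 2 \<and> U \<subseteq> carrier G \<and> (\<forall>u\<in>U. \<not> coinvolution x u) \<and>
          s \<in> generate G U" if s: "s \<in> S" for s
      proof (cases "coinvolution x s")
        case True
        have sV: "s \<in> carrier G" using s S by auto
        then obtain g where g: "g \<in> carrier G" "\<not> coinvolution x g" "\<not> coinvolution x (s \<otimes>\<^bsub>G\<^esub> g)"
          using generalized_dihedral_if_coinvolution[OF x(1) xx _ True] \<open>\<not> generalized_dihedral G\<close> by blast
        let ?U = "{g, s \<otimes>\<^bsub>G\<^esub> g}"
        have "(s \<otimes>\<^bsub>G\<^esub> g) \<otimes>\<^bsub>G\<^esub> inv\<^bsub>G\<^esub> g \<in> generate G ?U"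
          by (intro generate.eng generate.incl generate.inv) auto
        then have "s \<in> generate G ?U" using g sV by (simp add: m_assoc)
        moreover have "card ?U \<le> 2" by (simp add: card_insert_if)
        ultimately show ?thesis using g sV by (intro exI[of _ ?U]) auto
      next
        case False
        then show ?thesis using s S by (intro exI[of _ "{s}"]) (auto intro: generate.incl)
      qed
      then obtain U where U: "\<And>s. s \<in> S \<Longrightarrow> finite (U s) \<and> card (U s) \<le> 2 \<and> U s \<subseteq> carrier G \<and>
          (\<forall>u\<in>U s. \<not> coinvolution x u) \<and> s \<in> generate G (U s)" by metis
      define T where "T = (\<Union>s\<in>S. U s)"
      have T: "finite T" "T \<subseteq> carrier G" "\<forall>t\<in>T. \<not> coinvolution x t"
        using U S(1) unfolding T_def by blast+
      have "card T \<le> (\<Sum>s\<in>S. card (U s))" unfolding T_def using S(1) by (rule card_UN_le)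
      also have "\<dots> \<le> 2 * r" using sum_bounded_above[of S "\<lambda>s. card (U s)" 2] U S(4) by simp
      finally have cT: "card T \<le> 2 * r" .
      have sub: "subgroup (generate G (insert x T)) G"
        using T x by (intro generate_is_subgroup) auto
      have "S \<subseteq> generate G (insert x T)"
      proof
        fix s assume "s \<in> S"
        moreover from this have "generate G (U s) \<subseteq> generate G (insert x T)"
          by (intro mono_generate) (auto simp: T_def)
        ultimately show "s \<in> generate G (insert x T)" using U by blast
      qed
      then have "generate G (insert x T) = carrier G"
        using generate_subgroup_incl[OF _ sub, of S] S(3) subgroup.subset[OF sub] by auto
      then show ?thesis
        using ex_rigid_cayley_digraph[OF x(1) ord T(1,2) cT] T(3) by blast
    qed
    ultimately show ?thesis by blast
  qed
qed

end
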